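(* Let $X\in\mathbb{R}^{m\times n}$ have full row rank, let $Y\in\mathbb{R}^{k\times n}$, and put $A:=YX^{+}X$. Assume that the nonzero singular values of $A$ are pairwise distinct and that $\operatorname{rank}(A)\ge 1$. Let $\mathcal{M}$ be the set of real $k\times m$ matrices of rank exactly $1$, and let $F_0(W)=\tfrac12\|WX-Y\|_F^2$. Then the reduced rank regression solution $W_1^{(\mathrm{RRR})}=[A]_1X^{+}$ is the only strict local minimum of $F_0$ restricted to $\mathcal{M}$; that is, it is a strict local minimum of $F_0|_{\mathcal{M}}$ and no other point of $\mathcal{M}$ is a strict local minimum of $F_0|_{\mathcal{M}}$.
   Context: $X^{+}$ denotes the Moore--Penrose pseudo-inverse. $[A]_r$ denotes the matrix obtained by truncating the singular value decomposition of $A$ to its $r$ largest singular values. A strict local minimum of $F_0|_{\mathcal{M}}$ is a point $W_*\in\mathcal{M}$ having a neighborhood $U$ in $\mathcal{M}$ (in the topology induced from $\mathbb{R}^{k\times m}$) with $F_0(W_* )<F_0(W)$ for all $W\in U\setminus\{W_*\}$. *)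

theory Defs
  imports "HOL-Analysis.Analysis"
begin

(* The four Penrose equations; they have exactly one solution P for every real matrix X. *)
definition is_pseudo_inverse :: "real^'n^'m \<Rightarrow> real^'m^'n \<Rightarrow> bool" where
  "is_pseudo_inverse X P \<longleftrightarrow>
     X ** P ** X = X \<and> P ** X ** P = P \<and>
     transpose (X ** P) = X ** P \<and> transpose (P ** X) = P ** X"

definition pseudo_inverse :: "real^'n^'m \<Rightarrow> real^'m^'n" where
  "pseudo_inverse X = (THE P. is_pseudo_inverse X P)"

definition outer_product :: "real^'k \<Rightarrow> real^'n \<Rightarrow> real^'n^'k" where
  "outer_product u v = (\<chi> i j. u $ i * v $ j)"

abbreviation min_dim :: "real^'n^'k \<Rightarrow> nat" where
  "min_dim (A :: real^'n^'k) \<equiv> min CARD('k) CARD('n)"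

(* The thin form of the SVD, as a sum of rank-one terms: a diagonal factor cannot be written
   directly, because the index types 'k and 'n are unordered and unrelated.
   Only the values of s, u, v at indices below min_dim A are constrained. *)
definition is_svd ::
    "real^'n^'k \<Rightarrow> (nat \<Rightarrow> real) \<Rightarrow> (nat \<Rightarrow> real^'k) \<Rightarrow> (nat \<Rightarrow> real^'n) \<Rightarrow> bool" where
  "is_svd A s u v \<longleftrightarrow>
     (\<forall>i<min_dim A. \<forall>j<min_dim A. u i \<bullet> u j = (if i = j then 1 else 0)) \<and>
     (\<forall>i<min_dim A. \<forall>j<min_dim A. v i \<bullet> v j = (if i = j then 1 else 0)) \<and>
     (\<forall>i<min_dim A. 0 \<le> s i) \<and>
     (\<forall>j<min_dim A. \<forall>i\<le>j. s j \<le> s i) \<and>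
     A = (\<Sum>i<min_dim A. s i *\<^sub>R outer_product (u i) (v i))"

(* Decreasing and repeated with multiplicity, so that distinctness of singular values is
   injectivity in the index; meaningful (and independent of the choice) for i < min_dim A. *)
definition singular_value :: "real^'n^'k \<Rightarrow> nat \<Rightarrow> real" where
  "singular_value A = (SOME s. \<exists>u v. is_svd A s u v)"

(* Independent of the chosen SVD whenever the r-th and (r+1)-st largest singular values
   differ; otherwise one of the possible truncations. *)
definition truncated_svd :: "nat \<Rightarrow> real^'n^'k \<Rightarrow> real^'n^'k" where
  "truncated_svd r A =
     (SOME B. \<exists>s u v. is_svd A s u v \<and>
        B = (\<Sum>i<min r (min_dim A). s i *\<^sub>R outer_product (u i) (v i)))"

definition strict_local_min_on ::
    "'a::topological_space set \<Rightarrow> ('a \<Rightarrow> real) \<Rightarrow> 'a \<Rightarrow> bool" where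
  "strict_local_min_on M f w \<longleftrightarrow>
     w \<in> M \<and> (\<exists>U. openin (top_of_set M) U \<and> w \<in> U \<and> (\<forall>x\<in>U - {w}. f w < f x))"

definition rank_one_matrices :: "(real^'m^'k) set" where
  "rank_one_matrices = {W. rank W = 1}"

(* The norm of the type real^'n^'k is the Euclidean norm of the vector of row norms,
   which is the Frobenius norm. *)
definition F0 :: "real^'n^'m \<Rightarrow> real^'n^'k \<Rightarrow> real^'m^'k \<Rightarrow> real" where
  "F0 X Y W = 1 / 2 * (norm (W ** X - Y))\<^sup>2"

definition rrr_solution :: "nat \<Rightarrow> real^'n^'m \<Rightarrow> real^'n^'k \<Rightarrow> real^'m^'k" where
  "rrr_solution r X Y =
     truncated_svd r (Y ** pseudo_inverse X ** X) ** pseudo_inverse X"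

end

theory Submission
  imports Defs
begin

text \<open>With \<open>W = a b\<^sup>T\<close> and \<open>c = X\<^sup>T b\<close>, the objective is
  \<open>(\<parallel>a\<parallel>\<^sup>2 \<parallel>c\<parallel>\<^sup>2 - 2 a\<^sup>T A c + \<parallel>Y\<parallel>\<^sup>2) / 2\<close>, and full row rank
  turns the problem into one about \<open>a c\<^sup>T\<close> with \<open>c\<close> in the row space of
  \<open>X\<close>. Since the top singular value is simple, the global minimum is attained exactly at the
  leading SVD term. At any local minimum, stationarity in \<open>a\<close> and in \<open>c\<close> makes the two a
  singular pair; unless it is a top one, rotating it towards the top pair is a descent
  direction.\<close>

subsection \<open>Rank-one matrices\<close>

text \<open>The Frobenius inner product with a rank-one matrix is the bilinear form of
  \<open>A\<close>, which lets the whole matrix problem be treated in terms of the two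
  factors.\<close>

lemma inner_outer_product:
  fixes A :: "real^'n^'k"
  shows "outer_product a c \<bullet> A = a \<bullet> (A *v c)"
  by (simp add: outer_product_def inner_vec_def matrix_vector_mult_def sum_distrib_left ac_simps)

lemma outer_product_vector_mult: "outer_product a c *v x = (c \<bullet> x) *\<^sub>R a"
  by (simp add: outer_product_def inner_vec_def matrix_vector_mult_def vec_eq_iff
      sum_distrib_left ac_simps)

lemma norm_outer_product: "norm (outer_product a c) = norm a * norm c"
proof -
  have "(norm (outer_product a c))\<^sup>2 = (norm a * norm c)\<^sup>2"
    by (simp add: power2_norm_eq_inner inner_outer_product outer_product_vector_mult
        power_mult_distrib)
  then show ?thesis
    by (simp add: power2_eq_iff_nonneg)
qed

lemma outer_product_matrix_mult: "outer_product a b ** X = outer_product a (b v* X)"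
  by (simp add: outer_product_def matrix_matrix_mult_def vector_matrix_mult_def vec_eq_iff
      sum_distrib_left mult.assoc mult.commute mult.left_commute)

lemma outer_product_scaleR:
  "outer_product (x *\<^sub>R a) b = x *\<^sub>R outer_product a b"
  "outer_product a (x *\<^sub>R b) = x *\<^sub>R outer_product a b"
  by (simp_all add: outer_product_def vec_eq_iff)

lemma norm_diff_outer_product:
  fixes A :: "real^'n^'k"
  shows "(norm (outer_product a c - A))\<^sup>2
    = (norm a * norm c)\<^sup>2 - 2 * (a \<bullet> (A *v c)) + (norm A)\<^sup>2"
  unfolding norm_outer_product[symmetric] inner_outer_product[symmetric] power2_norm_eq_inner
  by (simp add: inner_diff_left inner_diff_right inner_commute[of A "outer_product a c"])

text \<open>If the column space has a one-element basis \<open>{a}\<close>, every column is a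
  multiple of \<open>a\<close>. Conversely, a nonzero matrix with range inside a line has rank
  neither 0 nor above 1.\<close>

lemma rank_eq_1_iff:
  fixes W :: "real^'m^'k"
  shows "rank W = 1 \<longleftrightarrow> (\<exists>a b. a \<noteq> 0 \<and> b \<noteq> 0 \<and> W = outer_product a b)"
proof
  assume r: "rank W = 1"
  obtain B where B: "B \<subseteq> range ((*v) W)" "independent B" "range ((*v) W) \<subseteq> span B"
    "card B = dim (range ((*v) W))"
    using basis_exists by blast
  with r obtain a where a: "B = {a}"
    by (metis card_1_singletonE rank_dim_range)
  have "\<exists>b. W *v x = b *\<^sub>R a" for x
    using B(3) a by (auto simp: span_singleton)
  then obtain f where f: "W *v x = f x *\<^sub>R a" for x
    by metis
  \<comment> \<open>The j-th entry of \<open>b\<close> is the coefficient of the j-th column of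
    \<open>W\<close> along \<open>a\<close>.\<close>
  define b where "b = (\<chi> j. f (axis j 1))"
  have W: "W = outer_product a b"
    unfolding vec_eq_iff
  proof (intro allI)
    fix i j
    have "W $ i $ j = (W *v axis j 1) $ i"
      using matrix_vector_mult_basis[of W j] by (simp add: column_def)
    then show "W $ i $ j = outer_product a b $ i $ j"
      by (simp only: f) (simp add: b_def outer_product_def)
  qed
  moreover have "W \<noteq> 0"
    using r by auto
  ultimately have "a \<noteq> 0" "b \<noteq> 0"
    by (auto simp: outer_product_def vec_eq_iff)
  with W show "\<exists>a b. a \<noteq> 0 \<and> b \<noteq> 0 \<and> W = outer_product a b"
    by blast
next
  assume "\<exists>a b. a \<noteq> 0 \<and> b \<noteq> 0 \<and> W = outer_product a b"
  then obtain a b where ab: "a \<noteq> 0" "b \<noteq> 0" and W: "W = outer_product a b"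
    by blast
  have "range ((*v) W) \<subseteq> span {a}"
    by (auto simp: W outer_product_vector_mult span_singleton)
  then have "rank W \<le> card {a}"
    unfolding rank_dim_range by (intro dim_le_card) auto
  moreover have "W \<noteq> 0"
    using ab norm_outer_product[of a b] by (auto simp: W)
  ultimately show "rank W = 1"
    using rank_eq_0[of W] by simp
qed

subsection \<open>The pseudo-inverse\<close>

text \<open>The symmetric matrices \<open>X ** P\<close> and \<open>X ** Q\<close> absorb each
  other, so transposing their product identifies them; the same works for \<open>P ** X\<close> and
  \<open>Q ** X\<close>. Then P = PXP = QXP = QXQ = Q.\<close>

lemma is_pseudo_inverse_unique:
  assumes P: "is_pseudo_inverse X P" and Q: "is_pseudo_inverse X Q"
  shows "P = Q"
proof -
  have p: "X ** P ** X = X" "P ** X ** P = P" "transpose (X ** P) = X ** P"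
    "transpose (P ** X) = P ** X"
    and q: "X ** Q ** X = X" "Q ** X ** Q = Q" "transpose (X ** Q) = X ** Q"
    "transpose (Q ** X) = Q ** X"
    using P Q by (auto simp: is_pseudo_inverse_def)
  have "X ** P = (X ** Q) ** (X ** P)"
    using q(1) by (simp add: matrix_mul_assoc)
  also have "\<dots> = transpose ((X ** P) ** (X ** Q))"
    by (simp only: matrix_transpose_mul[of "X ** P"] p(3) q(3))
  also have "(X ** P) ** (X ** Q) = X ** Q"
    using p(1) by (simp add: matrix_mul_assoc)
  finally have XP: "X ** P = X ** Q"
    by (simp only: q(3))
  have "P ** X = (P ** X) ** (Q ** X)"
    using q(1) by (simp flip: matrix_mul_assoc)
  also have "\<dots> = transpose ((Q ** X) ** (P ** X))"
    by (simp only: matrix_transpose_mul[of "Q ** X"] p(4) q(4))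
  also have "(Q ** X) ** (P ** X) = Q ** X"
    using p(1) by (simp flip: matrix_mul_assoc)
  finally have PX: "P ** X = Q ** X"
    by (simp only: q(4))
  have "P = Q ** (X ** P)"
    using p(2) PX by (simp add: matrix_mul_assoc)
  also have "\<dots> = Q"
    using q(2) XP by (simp add: matrix_mul_assoc)
  finally show ?thesis .
qed

text \<open>With full row rank the Gram matrix \<open>X ** transpose X\<close> has an inverse
  \<open>B\<close>, and \<open>transpose X ** B\<close> satisfies the Penrose equations. Uniqueness
  carries this over to the definite description.\<close>

lemma is_pseudo_inverse_pseudo_inverse:
  fixes X :: "real^'n^'m"
  assumes "rank X = CARD('m)"
  shows "is_pseudo_inverse X (pseudo_inverse X)"
proof -
  have inj: "inj ((*v) (transpose X))"
    using assms full_rank_injective[of "transpose X"] by (simp add: rank_transpose)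
  have "x = 0" if "(X ** transpose X) *v x = 0" for x
  proof -
    have "(transpose X *v x) \<bullet> (transpose X *v x) = x \<bullet> ((X ** transpose X) *v x)"
      by (simp add: dot_lmul_matrix flip: matrix_vector_mul_assoc)
    with that have "transpose X *v x = 0"
      by simp
    with inj show ?thesis
      by (intro injD[OF inj]) simp
  qed
  then obtain B where B: "B ** (X ** transpose X) = mat 1"
    using matrix_left_invertible_ker[of "X ** transpose X"] by blast
  then have B': "X ** transpose X ** B = mat 1"
    using matrix_left_right_inverse by blast
  \<comment> \<open>The Gram matrix is symmetric, so \<open>transpose B\<close> is a left inverse of
    it and must agree with the right inverse \<open>B\<close>.\<close>
  have "transpose (X ** transpose X ** B) = transpose B ** (X ** transpose X)"
    by (simp add: matrix_transpose_mul)
  then have "transpose B ** (X ** transpose X) = mat 1"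
    by (simp add: B')
  moreover have "transpose B = transpose B ** (X ** transpose X) ** B"
    using B' by (simp flip: matrix_mul_assoc)
  ultimately have sym: "transpose B = B"
    by simp
  have XP: "X ** (transpose X ** B) = mat 1"
    using B' by (simp add: matrix_mul_assoc)
  have PX: "transpose (transpose X ** B ** X) = transpose X ** B ** X"
    by (simp add: matrix_transpose_mul sym matrix_mul_assoc)
  have "transpose X ** B ** X ** (transpose X ** B) = transpose X ** B"
    by (simp add: XP flip: matrix_mul_assoc)
  with XP PX have P: "is_pseudo_inverse X (transpose X ** B)"
    unfolding is_pseudo_inverse_def by simp
  show ?thesis
    unfolding pseudo_inverse_def by (rule theI, fact P) (rule is_pseudo_inverse_unique[OF _ P])
qed

lemma matrix_mult_pseudo_inverse:
  fixes X :: "real^'n^'m"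
  assumes "rank X = CARD('m)"
  shows "X ** pseudo_inverse X = mat 1"
proof -
  obtain R where R: "X ** R = mat 1"
    using assms full_rank_surjective matrix_right_invertible_surjective by blast
  have "X ** pseudo_inverse X = X ** pseudo_inverse X ** X ** R"
    using R by (simp flip: matrix_mul_assoc)
  then show ?thesis
    using is_pseudo_inverse_pseudo_inverse[OF assms] R by (simp add: is_pseudo_inverse_def)
qed

subsection \<open>Existence of the singular value decomposition\<close>

text \<open>Only indices below \<open>r\<close> are constrained, matching \<open>is_svd\<close> and
  allowing extension by a function update at \<open>r\<close>.\<close>

definition orthonormal :: "nat \<Rightarrow> (nat \<Rightarrow> 'a::real_inner) \<Rightarrow> bool" where
  "orthonormal r u \<longleftrightarrow> (\<forall>i<r. \<forall>j<r. u i \<bullet> u j = (if i = j then 1 else 0))"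

lemma exists_unit_orthogonal:
  fixes u :: "nat \<Rightarrow> 'a::euclidean_space"
  assumes "r < DIM('a)"
  obtains x where "norm x = 1" "\<forall>i<r. x \<bullet> u i = 0"
proof -
  have "dim (u ` {..<r}) \<le> card (u ` {..<r})"
    by (intro dim_le_card) (auto intro: span_base)
  also have "\<dots> < DIM('a)"
    using card_image_le[of "{..<r}" u] assms by simp
  finally obtain x where x: "x \<noteq> 0" "\<And>y. y \<in> span (u ` {..<r}) \<Longrightarrow> orthogonal x y"
    using orthogonal_to_subspace_exists by blast
  then have "x \<bullet> u i = 0" if "i < r" for i
    using x(2)[OF span_base, of "u i"] that by (simp add: orthogonal_def)
  then show thesis
    using that[of "sgn x"] x(1) by (simp add: norm_sgn sgn_div_norm)
qed

text \<open>Orthonormality gives \<open>r\<close> distinct independent vectors, so with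
  \<open>r\<close> equal to the dimension they span the space, and \<open>x\<close> is orthogonal to
  itself.\<close>

lemma orthonormal_complete:
  fixes u :: "nat \<Rightarrow> 'a::euclidean_space"
  assumes u: "orthonormal r u" and r: "r = DIM('a)" and x: "\<forall>i<r. x \<bullet> u i = 0"
  shows "x = 0"
proof -
  have inj: "inj_on u {..<r}"
  proof (rule inj_onI)
    fix i j assume "i \<in> {..<r}" "j \<in> {..<r}" "u i = u j"
    with u have "u i \<bullet> u i = 1" "u i \<bullet> u i = (if i = j then 1 else 0)"
      by (simp add: orthonormal_def, metis lessThan_iff orthonormal_def)
    then show "i = j"
      by (simp split: if_splits)
  qed
  have "independent (u ` {..<r})"
  proof (rule pairwise_orthogonal_independent)
    show "pairwise orthogonal (u ` {..<r})"
      using u by (auto simp: pairwise_def orthogonal_def orthonormal_def)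
    show "0 \<notin> u ` {..<r}"
    proof
      assume "0 \<in> u ` {..<r}"
      then obtain i where i: "i < r" "u i = 0"
        by auto
      with u have "u i \<bullet> u i = 1"
        unfolding orthonormal_def by metis
      with i show False
        by simp
    qed
  qed
  then have "dim (u ` {..<r}) = DIM('a)"
    using inj r by (simp add: dim_eq_card_independent card_image)
  then have "span (u ` {..<r}) = UNIV"
    by (simp add: dim_eq_full)
  moreover have "orthogonal x y" if "y \<in> span (u ` {..<r})" for y
    by (rule orthogonal_to_span[OF that]) (use x in \<open>auto simp: orthogonal_def\<close>)
  ultimately show ?thesis
    using orthogonal_self[of x] by blast
qed

text \<open>Let \<open>y\<close> be the projection of \<open>x\<close> onto the span. Both
  \<open>y \<bullet> y\<close> and \<open>x \<bullet> y\<close> equal the sum, and the squared norm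
  of \<open>x - y\<close> is nonnegative.\<close>

lemma bessel_inequality:
  fixes u :: "nat \<Rightarrow> 'a::real_inner"
  assumes "orthonormal r u"
  shows "(\<Sum>i<r. (x \<bullet> u i)\<^sup>2) \<le> (norm x)\<^sup>2"
proof -
  define y where "y = (\<Sum>i<r. (x \<bullet> u i) *\<^sub>R u i)"
  have "y \<bullet> u j = x \<bullet> u j" if "j < r" for j
  proof -
    have "y \<bullet> u j = (\<Sum>i<r. if i = j then x \<bullet> u j else 0)"
      unfolding y_def inner_sum_left
      by (rule sum.cong) (use assms that in \<open>auto simp: orthonormal_def\<close>)
    with that show ?thesis
      by simp
  qed
  moreover have "z \<bullet> y = (\<Sum>i<r. (x \<bullet> u i) * (z \<bullet> u i))" for z
    by (simp add: y_def inner_sum_right)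
  ultimately have "y \<bullet> y = (\<Sum>i<r. (x \<bullet> u i)\<^sup>2)" "x \<bullet> y = (\<Sum>i<r. (x \<bullet> u i)\<^sup>2)"
    by (simp_all add: power2_eq_square)
  moreover have "0 \<le> (x - y) \<bullet> (x - y)"
    by simp
  ultimately show ?thesis
    by (simp add: power2_norm_eq_inner inner_diff_left inner_diff_right inner_commute[of y x])
qed

section \<open>Bilinear forms and the greedy construction of singular pairs\<close>

lemma sum_matrix_vector_mult:
  fixes f :: "'i \<Rightarrow> real^'n^'k"
  shows "sum f I *v x = (\<Sum>i\<in>I. f i *v x)"
  by (induction I rule: infinite_finite_induct)
    (simp_all add: matrix_vector_mult_add_rdistrib)

lemma inner_sum_outer_product:
  fixes u :: "nat \<Rightarrow> real^'k" and v :: "nat \<Rightarrow> real^'n"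
  shows "a \<bullet> ((\<Sum>i<r. s i *\<^sub>R outer_product (u i) (v i)) *v c)
    = (\<Sum>i<r. s i * ((a \<bullet> u i) * (c \<bullet> v i)))"
  by (simp add: sum_matrix_vector_mult inner_sum_right outer_product_vector_mult
      inner_commute[of c] mult_ac flip: outer_product_scaleR(1))

text \<open>Maximise the bilinear form over the compact product of the unit spheres of
  \<open>S\<close> and \<open>T\<close>; \<open>e\<close> and \<open>f\<close> make it nonempty. No
  derivatives are taken: testing the maximum against \<open>A *v c\<close> and
  \<open>a v* A\<close>, which stay in \<open>S\<close> and \<open>T\<close> by \<open>AT\<close>
  and \<open>AS\<close>, yields the singular pair equations.\<close>

lemma exists_maximal_singular_pair:
  fixes A :: "real^'n^'k"
  assumes S: "subspace S" and T: "subspace T"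
    and e: "e \<in> S" "norm e = 1" and f: "f \<in> T" "norm f = 1"
    and AT: "\<And>c. c \<in> T \<Longrightarrow> A *v c \<in> S" and AS: "\<And>a. a \<in> S \<Longrightarrow> a v* A \<in> T"
  obtains \<sigma> a c where "0 \<le> \<sigma>" "a \<in> S" "c \<in> T" "norm a = 1" "norm c = 1"
    "A *v c = \<sigma> *\<^sub>R a" "a v* A = \<sigma> *\<^sub>R c"
    "\<And>a' c'. a' \<in> S \<Longrightarrow> c' \<in> T \<Longrightarrow> a' \<bullet> (A *v c') \<le> \<sigma> * (norm a' * norm c')"
proof -
  let ?K = "(S \<inter> sphere 0 1) \<times> (T \<inter> sphere 0 1)"
  have "compact ?K"
    by (intro compact_Times closed_Int_compact closed_subspace S T compact_sphere)
  moreover have "(e, f) \<in> ?K"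
    using e f by simp
  moreover have "continuous_on ?K (\<lambda>p. fst p \<bullet> (A *v snd p))"
    by (intro continuous_intros linear_continuous_on_compose[OF _ matrix_vector_mul_linear])
  ultimately obtain p where p: "p \<in> ?K"
    and max: "\<And>q. q \<in> ?K \<Longrightarrow> fst q \<bullet> (A *v snd q) \<le> fst p \<bullet> (A *v snd p)"
    using continuous_attains_sup[of ?K "\<lambda>p. fst p \<bullet> (A *v snd p)"] by blast
  obtain a c where ac: "p = (a, c)"
    by (cases p)
  define \<sigma> where "\<sigma> = a \<bullet> (A *v c)"
  have a: "a \<in> S" "norm a = 1" and c: "c \<in> T" "norm c = 1"
    using p by (auto simp: ac)
  have bound: "a' \<bullet> (A *v c') \<le> \<sigma> * (norm a' * norm c')" if "a' \<in> S" "c' \<in> T" for a' c'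
  proof (cases "a' = 0 \<or> c' = 0")
    case False
    have "(sgn a', sgn c') \<in> ?K"
      using False that S T by (simp add: norm_sgn sgn_div_norm subspace_scale)
    from max[OF this] have "sgn a' \<bullet> (A *v sgn c') \<le> \<sigma>"
      by (simp add: ac \<sigma>_def)
    with False show ?thesis
      by (simp add: sgn_div_norm matrix_vector_mult_scaleR field_simps)
  qed auto
  have "0 \<le> \<sigma>"
    using bound[of "- a" c] a c S by (simp add: subspace_neg \<sigma>_def)
  \<comment> \<open>The equality case of Cauchy-Schwarz: the norm of \<open>y\<close> is at most
    \<open>\<sigma>\<close>, so the squared norm of \<open>y - \<sigma> *\<^sub>R x\<close> is at
    most \<sigma>^2 - 2 \<sigma>^2 + \<sigma>^2 = 0.\<close>
  have parallel: "y = \<sigma> *\<^sub>R x" if "y \<bullet> x = \<sigma>" "norm x = 1" "y \<bullet> y \<le> \<sigma> * norm y"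
    for x y :: "'b::real_inner"
  proof -
    have "norm y \<le> \<sigma>"
      using that(3) \<open>0 \<le> \<sigma>\<close> by (cases "y = 0") (auto simp: dot_square_norm power2_eq_square)
    then have "y \<bullet> y \<le> \<sigma>\<^sup>2"
      by (simp add: dot_square_norm power_mono)
    moreover have "x \<bullet> x = 1"
      using that by (simp add: dot_square_norm)
    ultimately have "(y - \<sigma> *\<^sub>R x) \<bullet> (y - \<sigma> *\<^sub>R x) \<le> 0"
      using that(1) by (simp add: inner_diff_left inner_diff_right inner_commute[of x y]
          power2_eq_square)
    then have "(y - \<sigma> *\<^sub>R x) \<bullet> (y - \<sigma> *\<^sub>R x) = 0"
      using inner_ge_zero[of "y - \<sigma> *\<^sub>R x"] by linarith
    then show ?thesis
      by (subst eq_iff_diff_eq_0) (simp only: inner_eq_zero_iff)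
  qed
  have "A *v c = \<sigma> *\<^sub>R a"
  proof (rule parallel)
    show "(A *v c) \<bullet> a = \<sigma>"
      by (simp add: \<sigma>_def inner_commute)
    show "(A *v c) \<bullet> (A *v c) \<le> \<sigma> * norm (A *v c)"
      using bound[OF AT[OF c(1)] c(1)] c(2) by simp
  qed fact
  moreover have "a v* A = \<sigma> *\<^sub>R c"
  proof (rule parallel)
    show "(a v* A) \<bullet> c = \<sigma>"
      by (simp add: \<sigma>_def dot_lmul_matrix)
    show "(a v* A) \<bullet> (a v* A) \<le> \<sigma> * norm (a v* A)"
      using bound[OF a(1) AS[OF a(1)]] a(2) by (simp add: dot_lmul_matrix)
  qed fact
  ultimately show thesis
    using that \<open>0 \<le> \<sigma>\<close> a c bound by blast
qed

text \<open>The state after \<open>r\<close> greedy choices. The last conjunct bounds what is left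
  on the orthogonal complements by every value already chosen, which makes the next value come out
  no larger.\<close>

definition partial_svd ::
    "real^'n^'k \<Rightarrow> nat \<Rightarrow> (nat \<Rightarrow> real) \<Rightarrow> (nat \<Rightarrow> real^'k) \<Rightarrow> (nat \<Rightarrow> real^'n) \<Rightarrow> bool" where
  "partial_svd A r s u v \<longleftrightarrow>
     orthonormal r u \<and> orthonormal r v \<and>
     (\<forall>i<r. 0 \<le> s i \<and> A *v v i = s i *\<^sub>R u i \<and> u i v* A = s i *\<^sub>R v i) \<and>
     (\<forall>j<r. \<forall>i\<le>j. s j \<le> s i) \<and>
     (\<forall>k<r. \<forall>a c. (\<forall>i<r. a \<bullet> u i = 0) \<longrightarrow> (\<forall>i<r. c \<bullet> v i = 0) \<longrightarrow>
        a \<bullet> (A *v c) \<le> s k * (norm a * norm c))"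

lemma orthonormal_extend:
  assumes "orthonormal r u" "norm x = 1" "\<forall>i<r. x \<bullet> u i = 0"
  shows "orthonormal (Suc r) (u(r := x))"
  using assms by (auto simp: orthonormal_def less_Suc_eq inner_commute dot_square_norm)

text \<open>The next term is a maximal singular pair on the orthogonal complements of the vectors
  found so far.\<close>

lemma exists_partial_svd:
  fixes A :: "real^'n^'k"
  assumes "r \<le> min_dim A"
  shows "\<exists>s u v. partial_svd A r s u v"
  using assms
proof (induction r)
  case 0
  then show ?case
    by (auto simp: partial_svd_def orthonormal_def)
next
  case (Suc r)
  then obtain s u v where r: "partial_svd A r s u v"
    by auto
  let ?S = "{a. \<forall>i<r. a \<bullet> u i = 0}" and ?T = "{c. \<forall>i<r. c \<bullet> v i = 0}"
  have "r < DIM(real^'k)" "r < DIM(real^'n)"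
    using Suc.prems by auto
  then obtain e f where e: "norm e = 1" "\<forall>i<r. e \<bullet> u i = 0" and f: "norm f = 1" "\<forall>i<r. f \<bullet> v i = 0"
    by (metis exists_unit_orthogonal)
  \<comment> \<open>The complements are preserved because the pairs found so far are singular for
    both \<open>A\<close> and its transpose.\<close>
  have AT: "A *v c \<in> ?S" if "c \<in> ?T" for c
    using that r by (auto simp: partial_svd_def inner_commute simp flip: dot_lmul_matrix)
  have AS: "a v* A \<in> ?T" if "a \<in> ?S" for a
    using that r by (auto simp: partial_svd_def dot_lmul_matrix)
  have "subspace ?S" "subspace ?T"
    by (auto simp: subspace_def inner_add_left)
  then obtain \<sigma> a c where \<sigma>: "0 \<le> \<sigma>" and ac: "a \<in> ?S" "c \<in> ?T" "norm a = 1" "norm c = 1"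
    and sing: "A *v c = \<sigma> *\<^sub>R a" "a v* A = \<sigma> *\<^sub>R c"
    and bound: "\<And>a' c'. a' \<in> ?S \<Longrightarrow> c' \<in> ?T \<Longrightarrow> a' \<bullet> (A *v c') \<le> \<sigma> * (norm a' * norm c')"
    using e f AT AS by (elim exists_maximal_singular_pair[of ?S ?T e f A]) auto
  define s' u' v' where "s' = s(r := \<sigma>)" and "u' = u(r := a)" and "v' = v(r := c)"
  have le: "\<sigma> \<le> s k" if "k < r" for k
  proof -
    have "a \<bullet> (A *v c) \<le> s k * (norm a * norm c)"
      using r ac that unfolding partial_svd_def by blast
    then show ?thesis
      using ac by (simp add: sing dot_square_norm)
  qed
  have "orthonormal (Suc r) u'" "orthonormal (Suc r) v'"
    using r ac by (auto simp: u'_def v'_def partial_svd_def intro!: orthonormal_extend)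
  moreover have "0 \<le> s' i \<and> A *v v' i = s' i *\<^sub>R u' i \<and> u' i v* A = s' i *\<^sub>R v' i"
    if "i < Suc r" for i
    using that r \<sigma> sing by (auto simp: s'_def u'_def v'_def partial_svd_def less_Suc_eq)
  moreover have "s' j \<le> s' i" if "j < Suc r" "i \<le> j" for i j
    using that r le by (auto simp: s'_def partial_svd_def less_Suc_eq)
  moreover have "a' \<bullet> (A *v c') \<le> s' k * (norm a' * norm c')"
    if "k < Suc r" "\<forall>i<Suc r. a' \<bullet> u' i = 0" "\<forall>i<Suc r. c' \<bullet> v' i = 0" for k a' c'
  proof -
    have "a' \<in> ?S" "c' \<in> ?T"
      using that unfolding u'_def v'_def
      by (auto simp del: fun_upd_apply) (metis fun_upd_other less_Suc_eq nat_neq_iff)+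
    from bound[OF this] have "a' \<bullet> (A *v c') \<le> \<sigma> * (norm a' * norm c')" .
    also have "\<dots> \<le> s' k * (norm a' * norm c')"
      using le that(1) by (intro mult_right_mono) (auto simp: s'_def less_Suc_eq)
    finally show ?thesis .
  qed
  ultimately have "partial_svd A (Suc r) s' u' v'"
    unfolding partial_svd_def by blast
  then show ?case
    by blast
qed

text \<open>The sum \<open>B\<close> of the greedy terms agrees with \<open>A\<close> on all chosen
  singular vectors, from the left and from the right; completeness on one side then forces
  \<open>A = B\<close>.\<close>

lemma exists_svd:
  fixes A :: "real^'n^'k"
  shows "\<exists>s u v. is_svd A s u v"
proof -
  let ?r = "min_dim A"
  obtain s u v where r: "partial_svd A ?r s u v"
    using exists_partial_svd by blast
  define B where "B = (\<Sum>i<?r. s i *\<^sub>R outer_product (u i) (v i))"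
  have inner_B: "a \<bullet> (B *v c) = (\<Sum>i<?r. s i * ((a \<bullet> u i) * (c \<bullet> v i)))" for a c
    unfolding B_def by (rule inner_sum_outer_product)
  have u: "u i \<bullet> u j = (if i = j then 1 else 0)" "v i \<bullet> v j = (if i = j then 1 else 0)"
    if "i < ?r" "j < ?r" for i j
    using r that by (auto simp: partial_svd_def orthonormal_def)
  have right: "(A - B) *v v j = 0" if "j < ?r" for j
  proof -
    have "a \<bullet> (B *v v j) = a \<bullet> (A *v v j)" for a
    proof -
      have "a \<bullet> (B *v v j) = (\<Sum>i<?r. if i = j then s j * (a \<bullet> u j) else 0)"
        unfolding inner_B by (rule sum.cong) (use u that in auto)
      then show ?thesis
        using that r by (simp add: partial_svd_def)
    qed
    then show ?thesis
      by (metis eq_iff_diff_eq_0 matrix_vector_mult_diff_rdistrib vector_eq_ldot)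
  qed
  have left: "u j v* (A - B) = 0" if "j < ?r" for j
  proof -
    have "(u j v* (A - B)) \<bullet> c = 0" for c
    proof -
      have "u j \<bullet> (B *v c) = (\<Sum>i<?r. if i = j then s j * (c \<bullet> v j) else 0)"
        unfolding inner_B by (rule sum.cong) (use u that in auto)
      also have "\<dots> = (u j v* A) \<bullet> c"
        using that r by (simp add: partial_svd_def inner_commute)
      finally show ?thesis
        by (simp add: dot_lmul_matrix matrix_vector_mult_diff_rdistrib inner_diff_right)
    qed
    then show ?thesis
      by (metis inner_eq_zero_iff)
  qed
  have "A - B = 0"
  \<comment> \<open>Only the family in the smaller space is a full basis: \<open>v\<close>
    annihilates the rows of \<open>A - B\<close> in one case, \<open>u\<close> the columns in the
    other.\<close>
  proof (cases "CARD('n) \<le> CARD('k)")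
    case True
    have "(A - B) $ i = 0" for i
    proof (rule orthonormal_complete[of ?r v])
      show "\<forall>j<?r. (A - B) $ i \<bullet> v j = 0"
        using right by (metis matrix_vector_mul_component zero_index)
    qed (use True r in \<open>auto simp: partial_svd_def\<close>)
    then show ?thesis
      by (simp add: vec_eq_iff)
  next
    case False
    have "column i (A - B) = 0" for i
    proof (rule orthonormal_complete[of ?r u])
      have "column i (A - B) \<bullet> u j = (u j v* (A - B)) $ i" for j
        by (simp add: column_def vector_matrix_mult_def inner_vec_def mult.commute)
      then show "\<forall>j<?r. column i (A - B) \<bullet> u j = 0"
        using left by simp
    qed (use False r in \<open>auto simp: partial_svd_def\<close>)
    then show ?thesis
      by (simp add: vec_eq_iff column_def)
  qed
  then have "is_svd A s u v"
    using r u unfolding is_svd_def partial_svd_def B_def by simp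
  then show ?thesis
    by blast
qed

subsection \<open>Best rank-one approximation\<close>

lemma is_svd_orthonormal:
  fixes A :: "real^'n^'k"
  assumes "is_svd A s u v"
  shows "orthonormal (min_dim A) u" "orthonormal (min_dim A) v"
  using assms by (auto simp: is_svd_def orthonormal_def)

lemma is_svd_inner:
  fixes A :: "real^'n^'k"
  assumes "is_svd A s u v"
  shows "a \<bullet> (A *v c) = (\<Sum>i<min_dim A. s i * ((a \<bullet> u i) * (c \<bullet> v i)))"
proof -
  have "A = (\<Sum>i<min_dim A. s i *\<^sub>R outer_product (u i) (v i))"
    using assms by (simp add: is_svd_def)
  from arg_cong[OF this, of "\<lambda>B. a \<bullet> (B *v c)"] show ?thesis
    unfolding inner_sum_outer_product .
qed

lemma is_svd_singular_pair:
  fixes A :: "real^'n^'k"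
  assumes svd: "is_svd A s u v" and j: "j < min_dim A"
  shows "A *v v j = s j *\<^sub>R u j" "u j v* A = s j *\<^sub>R v j"
proof -
  have orth: "u i \<bullet> u j = (if i = j then 1 else 0)" "v i \<bullet> v j = (if i = j then 1 else 0)"
    if "i < min_dim A" for i
    using is_svd_orthonormal[OF svd] that j unfolding orthonormal_def by blast+
  have "a \<bullet> (A *v v j) = a \<bullet> (s j *\<^sub>R u j)" for a
  proof -
    have "a \<bullet> (A *v v j) = (\<Sum>i<min_dim A. if i = j then s j * (a \<bullet> u j) else 0)"
      unfolding is_svd_inner[OF svd]
      by (rule sum.cong) (use orth in \<open>auto simp: inner_commute[of "v j"]\<close>)
    with j show ?thesis
      by simp
  qed
  then show "A *v v j = s j *\<^sub>R u j"
    using vector_eq_ldot by blast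
  have "(u j v* A) \<bullet> c = (s j *\<^sub>R v j) \<bullet> c" for c
  proof -
    have "(u j v* A) \<bullet> c = (\<Sum>i<min_dim A. if i = j then s j * (c \<bullet> v j) else 0)"
      unfolding dot_lmul_matrix is_svd_inner[OF svd]
      by (rule sum.cong) (use orth in \<open>auto simp: inner_commute[of "u j"]\<close>)
    with j show ?thesis
      by (simp add: inner_commute)
  qed
  then show "u j v* A = s j *\<^sub>R v j"
    using vector_eq_rdot by blast
qed

text \<open>Index types are nonempty, so \<open>min_dim A\<close> is positive and index 0 is always
  constrained.\<close>

lemma is_svd_norm_0:
  fixes A :: "real^'n^'k"
  assumes "is_svd A s u v"
  shows "norm (u 0) = 1" "norm (v 0) = 1"
  using assms unfolding is_svd_def by (simp_all add: norm_eq_sqrt_inner)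

lemma is_svd_pos:
  fixes A :: "real^'n^'k"
  assumes "is_svd A s u v" and "A \<noteq> 0"
  shows "0 < s 0"
proof (rule ccontr)
  assume "\<not> 0 < s 0"
  moreover have "0 \<le> s i" "s i \<le> s 0" if "i < min_dim A" for i
    using assms that unfolding is_svd_def by auto
  ultimately have "s i = 0" if "i < min_dim A" for i
    using that by (meson dual_order.trans not_le order_antisym)
  then have "A = 0"
    using assms unfolding is_svd_def by simp
  with assms show False
    by simp
qed

text \<open>AM-GM for each singular direction, followed by Bessel; taking \<open>\<sigma>\<close> between the
  top two singular values keeps the two leading coefficients visible, and with them the equality
  case.\<close>

lemma is_svd_inner_bound:
  fixes A :: "real^'n^'k"
  assumes svd: "is_svd A s u v" and \<sigma>: "0 \<le> \<sigma>" "\<sigma> \<le> s 0"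
    and le: "\<And>i. 0 < i \<Longrightarrow> i < min_dim A \<Longrightarrow> s i \<le> \<sigma>"
  shows "2 * (a \<bullet> (A *v c)) \<le> \<sigma> * ((norm a)\<^sup>2 + (norm c)\<^sup>2)
    + (s 0 - \<sigma>) * ((a \<bullet> u 0)\<^sup>2 + (c \<bullet> v 0)\<^sup>2)"
proof -
  define q where "q i = (a \<bullet> u i)\<^sup>2 + (c \<bullet> v i)\<^sup>2" for i
  have "2 * (a \<bullet> (A *v c)) = (\<Sum>i<min_dim A. s i * (2 * (a \<bullet> u i) * (c \<bullet> v i)))"
    unfolding is_svd_inner[OF svd] sum_distrib_left by (simp add: mult_ac)
  also have "\<dots> \<le> (\<Sum>i<min_dim A. \<sigma> * q i + (if i = 0 then (s 0 - \<sigma>) * q 0 else 0))"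
  proof (rule sum_mono)
    fix i assume i: "i \<in> {..<min_dim A}"
    have "s i * (2 * (a \<bullet> u i) * (c \<bullet> v i)) \<le> s i * q i"
      unfolding q_def using svd i
      by (intro mult_left_mono sum_squares_bound) (auto simp: is_svd_def)
    \<comment> \<open>At \<open>i = 0\<close> this is an equality; every other \<open>s i\<close> is
      at most \<open>\<sigma>\<close>.\<close>
    also have "\<dots> \<le> \<sigma> * q i + (if i = 0 then (s 0 - \<sigma>) * q 0 else 0)"
      using le[of i] i by (auto simp: q_def algebra_simps intro!: add_mono mult_right_mono)
    finally show "s i * (2 * (a \<bullet> u i) * (c \<bullet> v i))
      \<le> \<sigma> * q i + (if i = 0 then (s 0 - \<sigma>) * q 0 else 0)" .
  qed
  also have "\<dots> = \<sigma> * (\<Sum>i<min_dim A. q i) + (s 0 - \<sigma>) * q 0"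
    by (simp add: sum.distrib sum_distrib_left)
  also have "\<dots> \<le> \<sigma> * ((norm a)\<^sup>2 + (norm c)\<^sup>2) + (s 0 - \<sigma>) * q 0"
    unfolding q_def sum.distrib
    by (intro add_right_mono mult_left_mono add_mono bessel_inequality is_svd_orthonormal[OF svd] \<sigma>)
  finally show ?thesis
    by (simp add: q_def)
qed

text \<open>Choosing \<open>\<sigma> = s 0\<close> removes the second summand of the bound;
  normalising both vectors turns the sum of squares into 2, and homogeneity does the rest.\<close>

lemma is_svd_inner_le:
  fixes A :: "real^'n^'k"
  assumes svd: "is_svd A s u v"
  shows "a \<bullet> (A *v c) \<le> s 0 * (norm a * norm c)"
proof (cases "a = 0 \<or> c = 0")
  case False
  have s: "0 \<le> s 0" "\<And>i. i < min_dim A \<Longrightarrow> s i \<le> s 0"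
    using svd by (auto simp: is_svd_def)
  have "2 * (sgn a \<bullet> (A *v sgn c)) \<le> s 0 * ((norm (sgn a))\<^sup>2 + (norm (sgn c))\<^sup>2)"
    using is_svd_inner_bound[OF svd, of "s 0" "sgn a" "sgn c"] s by simp
  with False show ?thesis
    by (simp add: norm_sgn) (simp add: sgn_div_norm matrix_vector_mult_scaleR field_simps)
qed auto

lemma unit_vector_eq_scaleR:
  fixes x y :: "'a::real_inner"
  assumes "norm x = 1" "norm y = 1" "1 \<le> (x \<bullet> y)\<^sup>2"
  shows "x = (x \<bullet> y) *\<^sub>R y"
proof -
  have "x \<bullet> x = 1" "y \<bullet> y = 1"
    using assms by (simp_all add: dot_square_norm)
  then have "(x - (x \<bullet> y) *\<^sub>R y) \<bullet> (x - (x \<bullet> y) *\<^sub>R y) = 1 - (x \<bullet> y)\<^sup>2"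
    by (simp add: inner_diff_left inner_diff_right inner_commute[of y x] power2_eq_square)
  then have "(x - (x \<bullet> y) *\<^sub>R y) \<bullet> (x - (x \<bullet> y) *\<^sub>R y) = 0"
    using assms(3) inner_ge_zero[of "x - (x \<bullet> y) *\<^sub>R y"] by linarith
  then show ?thesis
    by (subst eq_iff_diff_eq_0) (simp only: inner_eq_zero_iff)
qed

text \<open>A gap below \<open>s 0\<close> forces \<alpha>^2 + \<gamma>^2 to reach its maximum 2, so
  \<open>a\<close> and \<open>c\<close> are \<open>u 0\<close> and \<open>v 0\<close> up to signs.
  The signs agree because the form is positive, and they cancel in the outer product.\<close>

lemma is_svd_inner_eq:
  fixes A :: "real^'n^'k"
  assumes svd: "is_svd A s u v" and pos: "0 < s 0"
    and simple: "\<And>i. 0 < i \<Longrightarrow> i < min_dim A \<Longrightarrow> s i < s 0"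
    and unit: "norm a = 1" "norm c = 1" and eq: "a \<bullet> (A *v c) = s 0"
  shows "outer_product a c = outer_product (u 0) (v 0)"
proof -
  \<comment> \<open>The second singular value, or 0 when there is only one index; either way
    strictly below \<open>s 0\<close>.\<close>
  define \<sigma> where "\<sigma> = (if 1 < min_dim A then s 1 else 0)"
  have \<sigma>: "0 \<le> \<sigma>" "\<sigma> < s 0"
    using svd pos simple unfolding \<sigma>_def is_svd_def by auto
  have le: "s i \<le> \<sigma>" if "0 < i" "i < min_dim A" for i
    using svd that unfolding \<sigma>_def is_svd_def by auto
  define \<alpha> \<gamma> where "\<alpha> = a \<bullet> u 0" and "\<gamma> = c \<bullet> v 0"
  have "2 * s 0 \<le> \<sigma> * 2 + (s 0 - \<sigma>) * (\<alpha>\<^sup>2 + \<gamma>\<^sup>2)"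
    using is_svd_inner_bound[OF svd \<sigma>(1) _ le, of a c] \<sigma>(2) unit eq by (simp add: \<alpha>_def \<gamma>_def)
  then have "(s 0 - \<sigma>) * 2 \<le> (s 0 - \<sigma>) * (\<alpha>\<^sup>2 + \<gamma>\<^sup>2)"
    by (simp add: algebra_simps)
  then have ge: "2 \<le> \<alpha>\<^sup>2 + \<gamma>\<^sup>2"
    by (rule mult_left_le_imp_le) (use \<sigma>(2) in simp)
  have "\<bar>\<alpha>\<bar> \<le> 1" "\<bar>\<gamma>\<bar> \<le> 1"
    using Cauchy_Schwarz_ineq2[of a "u 0"] Cauchy_Schwarz_ineq2[of c "v 0"] unit
      is_svd_norm_0[OF svd] by (simp_all add: \<alpha>_def \<gamma>_def)
  then have "\<alpha>\<^sup>2 \<le> 1" "\<gamma>\<^sup>2 \<le> 1"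
    by (simp_all add: abs_square_le_1)
  with ge have "1 \<le> \<alpha>\<^sup>2" "1 \<le> \<gamma>\<^sup>2"
    by linarith+
  then have a: "a = \<alpha> *\<^sub>R u 0" and c: "c = \<gamma> *\<^sub>R v 0"
    using unit is_svd_norm_0[OF svd] unfolding \<alpha>_def \<gamma>_def by (intro unit_vector_eq_scaleR; simp)+
  have "a \<bullet> (A *v c) = \<alpha> * \<gamma> * s 0"
    using is_svd_singular_pair(1)[OF svd, of 0] is_svd_norm_0[OF svd]
    by (subst a, subst c) (simp add: matrix_vector_mult_scaleR dot_square_norm)
  with eq pos have "\<alpha> * \<gamma> = 1"
    by simp
  moreover have "outer_product a c = (\<alpha> * \<gamma>) *\<^sub>R outer_product (u 0) (v 0)"
    by (subst a, subst c) (simp add: outer_product_scaleR)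
  ultimately show ?thesis
    by simp
qed

text \<open>By \<open>norm_diff_outer_product\<close>, \<open>outer_objective A a c\<close> is
  \<open>\<parallel>a c\<^sup>T - A\<parallel>\<^sup>2 - \<parallel>A\<parallel>\<^sup>2\<close>.\<close>

definition outer_objective :: "real^'n^'k \<Rightarrow> real^'k \<Rightarrow> real^'n \<Rightarrow> real" where
  "outer_objective A a c = (norm a * norm c)\<^sup>2 - 2 * (a \<bullet> (A *v c))"

text \<open>With t the product of the two norms, the objective is at least t^2 - 2 s_0 t, and
  completing the square gives the bound.\<close>

lemma outer_objective_ge:
  fixes A :: "real^'n^'k"
  assumes svd: "is_svd A s u v"
  shows "- (s 0)\<^sup>2 \<le> outer_objective A a c"
proof -
  have "0 \<le> (norm a * norm c - s 0)\<^sup>2"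
    by simp
  then show ?thesis
    using is_svd_inner_le[OF svd, of a c]
    by (simp add: outer_objective_def power2_diff mult.commute[of "s 0"])
qed

text \<open>Both estimates behind the lower bound must be tight: the product of the norms is
  \<open>s 0\<close>, and the normalised factors attain the maximum of the bilinear form.\<close>

lemma outer_objective_eq:
  fixes A :: "real^'n^'k"
  assumes svd: "is_svd A s u v" and pos: "0 < s 0"
    and simple: "\<And>i. 0 < i \<Longrightarrow> i < min_dim A \<Longrightarrow> s i < s 0"
    and le: "outer_objective A a c \<le> - (s 0)\<^sup>2"
  shows "outer_product a c = s 0 *\<^sub>R outer_product (u 0) (v 0)"
proof -
  let ?t = "norm a * norm c"
  have "(?t - s 0)\<^sup>2 \<le> 2 * (a \<bullet> (A *v c)) - 2 * (s 0 * ?t)"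
    using le by (simp add: outer_objective_def power2_diff mult.commute[of "s 0"])
  then have "(?t - s 0)\<^sup>2 \<le> 0" and eq: "s 0 * ?t \<le> a \<bullet> (A *v c)"
    using is_svd_inner_le[OF svd, of a c] zero_le_power2[of "?t - s 0"] by linarith+
  then have t: "?t = s 0"
    by simp
  then have nz: "a \<noteq> 0" "c \<noteq> 0"
    using pos by auto
  have "a \<bullet> (A *v c) = s 0 * ?t"
    using eq is_svd_inner_le[OF svd, of a c] by simp
  then have "sgn a \<bullet> (A *v sgn c) = s 0"
    using nz by (simp add: sgn_div_norm matrix_vector_mult_scaleR field_simps)
  then have "outer_product (sgn a) (sgn c) = outer_product (u 0) (v 0)"
    using nz by (intro is_svd_inner_eq[OF svd pos simple]) (auto simp: norm_sgn)
  moreover have "outer_product a c = ?t *\<^sub>R outer_product (sgn a) (sgn c)"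
    using nz by (simp add: sgn_div_norm outer_product_scaleR field_simps)
  ultimately show ?thesis
    by (simp add: t)
qed

lemma outer_objective_is_svd:
  fixes A :: "real^'n^'k"
  assumes svd: "is_svd A s u v"
  shows "outer_objective A (s 0 *\<^sub>R u 0) (v 0) = - (s 0)\<^sup>2"
proof -
  have "u 0 \<bullet> (A *v v 0) = s 0"
    using is_svd_singular_pair(1)[OF svd, of 0] is_svd_norm_0[OF svd] by (simp add: dot_square_norm)
  then show ?thesis
    using is_svd_norm_0[OF svd] by (simp add: outer_objective_def power2_eq_square)
qed

text \<open>The choice operator is harmless: the leading term of any SVD attains the minimum of the
  objective, and a simple top singular value makes the minimiser unique.\<close>

lemma truncated_svd_1:
  fixes A :: "real^'n^'k"
  assumes svd: "is_svd A s u v" and pos: "0 < s 0"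
    and simple: "\<And>i. 0 < i \<Longrightarrow> i < min_dim A \<Longrightarrow> s i < s 0"
  shows "truncated_svd 1 A = s 0 *\<^sub>R outer_product (u 0) (v 0)"
  unfolding truncated_svd_def
proof (rule some_equality)
  have 1: "{..<min 1 (min_dim A)} = {0}"
    by (auto simp: Suc_le_eq)
  show "\<exists>s' u' v'. is_svd A s' u' v' \<and> s 0 *\<^sub>R outer_product (u 0) (v 0)
      = (\<Sum>i<min 1 (min_dim A). s' i *\<^sub>R outer_product (u' i) (v' i))"
    unfolding 1 using svd by auto
  fix B assume "\<exists>s' u' v'. is_svd A s' u' v' \<and>
      B = (\<Sum>i<min 1 (min_dim A). s' i *\<^sub>R outer_product (u' i) (v' i))"
  then obtain s' u' v' where svd': "is_svd A s' u' v'"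
    and B: "B = s' 0 *\<^sub>R outer_product (u' 0) (v' 0)"
    unfolding 1 by auto
  have "0 \<le> s' 0"
    using svd' by (simp add: is_svd_def)
  \<comment> \<open>The lower bound from one SVD is evaluated at the leading pair of the
    other.\<close>
  moreover have "- (s' 0)\<^sup>2 \<le> - (s 0)\<^sup>2"
    using outer_objective_ge[OF svd'] outer_objective_is_svd[OF svd] by metis
  ultimately have "outer_objective A (s' 0 *\<^sub>R u' 0) (v' 0) \<le> - (s 0)\<^sup>2"
    using outer_objective_is_svd[OF svd'] by simp
  from outer_objective_eq[OF svd pos simple this]
  show "B = s 0 *\<^sub>R outer_product (u 0) (v 0)"
    by (simp add: B outer_product_scaleR)
qed

subsection \<open>Local minima on the rank-one matrices\<close>

text \<open>\<open>pseudo_inverse X ** X\<close> is the orthogonal projection onto the row space of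
  \<open>X\<close>, so \<open>Y\<close> and its projected version agree on \<open>b v* X\<close> and
  may be exchanged in the cross term.\<close>

lemma F0_outer_product:
  fixes X :: "real^'n^'m" and Y :: "real^'n^'k"
  assumes "rank X = CARD('m)"
  shows "F0 X Y (outer_product a b)
    = (outer_objective (Y ** pseudo_inverse X ** X) a (b v* X) + (norm Y)\<^sup>2) / 2"
proof -
  have "pseudo_inverse X ** X *v (b v* X) = b v* X"
  proof -
    have "transpose X = transpose (pseudo_inverse X ** X) ** transpose X"
      using matrix_mult_pseudo_inverse[OF assms]
      by (simp add: matrix_mul_assoc flip: matrix_transpose_mul)
    also have "\<dots> = pseudo_inverse X ** X ** transpose X"
      using is_pseudo_inverse_pseudo_inverse[OF assms] by (simp add: is_pseudo_inverse_def)
    finally show ?thesis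
      by (metis matrix_vector_mul_assoc transpose_matrix_vector)
  qed
  then have "Y ** pseudo_inverse X ** X *v (b v* X) = Y *v (b v* X)"
    by (metis matrix_mul_assoc matrix_vector_mul_assoc)
  then show ?thesis
    by (simp add: F0_def outer_product_matrix_mult norm_diff_outer_product outer_objective_def)
qed

text \<open>Every \<open>y v* A\<close>, for the projected \<open>A\<close>, lies in the row space
  of \<open>X\<close>; membership is expressed as being fixed by the projection.\<close>

lemma vector_mult_pseudo_inverse_cancel:
  fixes X :: "real^'n^'m" and Y :: "real^'n^'k"
  assumes "rank X = CARD('m)"
  shows "((y v* (Y ** pseudo_inverse X ** X)) v* pseudo_inverse X) v* X
    = y v* (Y ** pseudo_inverse X ** X)"
proof -
  have "Y ** pseudo_inverse X ** X ** pseudo_inverse X ** X = Y ** pseudo_inverse X ** X"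
    using matrix_mult_pseudo_inverse[OF assms]
    by (metis matrix_mul_assoc matrix_mul_rid)
  then show ?thesis
    by (metis matrix_mul_assoc vector_matrix_mul_assoc)
qed

section \<open>Variation along curves of rank-one matrices\<close>

lemma mem_rank_one_matrices_iff:
  "W \<in> rank_one_matrices \<longleftrightarrow> (\<exists>a b. a \<noteq> 0 \<and> b \<noteq> 0 \<and> W = outer_product a b)"
  unfolding rank_one_matrices_def mem_Collect_eq by (rule rank_eq_1_iff)

text \<open>For small \<open>t\<close> both factors stay nonzero, so the curve remains in the
  rank-one set and inside the neighbourhood. The inequality is weak because the curve may return to
  the same matrix.\<close>

lemma strict_local_min_on_rank_one_eventually:
  fixes \<alpha> :: "real \<Rightarrow> real^'k" and \<beta> :: "real \<Rightarrow> real^'m"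
  assumes min: "strict_local_min_on rank_one_matrices f (outer_product (\<alpha> 0) (\<beta> 0))"
    and cont: "isCont \<alpha> 0" "isCont \<beta> 0"
  shows "\<forall>\<^sub>F t in at_right 0. f (outer_product (\<alpha> 0) (\<beta> 0)) \<le> f (outer_product (\<alpha> t) (\<beta> t))"
proof -
  let ?M = "rank_one_matrices :: (real^'m^'k) set"
  let ?W = "\<lambda>t. outer_product (\<alpha> t) (\<beta> t)"
  obtain U where M: "?W 0 \<in> ?M" and U: "openin (top_of_set ?M) U" "?W 0 \<in> U"
    and less: "\<And>x. x \<in> U - {?W 0} \<Longrightarrow> f (?W 0) < f x"
    using min unfolding strict_local_min_on_def by blast
  from U(1) obtain V where V: "open V" "U = ?M \<inter> V"
    by (auto simp: openin_open)
  have nz: "\<alpha> 0 \<noteq> 0" "\<beta> 0 \<noteq> 0"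
    using M by (auto simp: rank_one_matrices_def outer_product_def zero_vec_def[symmetric])
  have "isCont ?W 0"
    using cont unfolding outer_product_def isCont_def by (intro tendsto_intros)
  then have "(?W \<longlongrightarrow> ?W 0) (at_right 0)" "(\<alpha> \<longlongrightarrow> \<alpha> 0) (at_right 0)" "(\<beta> \<longlongrightarrow> \<beta> 0) (at_right 0)"
    using cont unfolding isCont_def by (auto intro: tendsto_within_subset)
  then have "\<forall>\<^sub>F t in at_right 0. ?W t \<in> V" "\<forall>\<^sub>F t in at_right 0. \<alpha> t \<noteq> 0"
    "\<forall>\<^sub>F t in at_right 0. \<beta> t \<noteq> 0"
    using V U(2) nz by (auto intro: topological_tendstoD tendsto_imp_eventually_ne)
  then show ?thesis
  proof eventually_elim
    case (elim t)
    then have "?W t \<in> U"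
      using V by (auto simp: mem_rank_one_matrices_iff)
    with less[of "?W t"] show ?case
      by (cases "?W t = ?W 0") auto
  qed
qed

text \<open>Dividing by positive \<open>t\<close> and letting it tend to 0 gives the first-order
  necessary condition.\<close>

lemma eventually_at_right_quadratic_nonneg:
  fixes p q :: real
  assumes "\<forall>\<^sub>F t in at_right 0. 0 \<le> t * p + t\<^sup>2 * q"
  shows "0 \<le> p"
proof -
  have "\<forall>\<^sub>F t in at_right 0. 0 \<le> p + t * q"
    using assms eventually_at_right_less[of 0]
  proof eventually_elim
    case (elim t)
    then have "0 \<le> t * (p + t * q)"
      by (simp add: algebra_simps power2_eq_square)
    with elim show ?case
      by (simp add: zero_le_mult_iff)
  qed
  moreover have "((\<lambda>t. p + t * q) \<longlongrightarrow> p + 0 * q) (at_right 0)"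
    by (intro tendsto_intros)
  ultimately show ?thesis
    using tendsto_lowerbound[of "\<lambda>t. p + t * q" "p + 0 * q" "at_right 0" 0] by simp
qed

lemma norm_add_scaleR_power2:
  fixes x y :: "'a::real_inner"
  shows "(norm (x + t *\<^sub>R y))\<^sup>2 = (norm x)\<^sup>2 + 2 * t * (x \<bullet> y) + t\<^sup>2 * (norm y)\<^sup>2"
  by (simp add: power2_norm_eq_inner inner_add_left inner_add_right inner_commute[of y x])
    (simp add: power2_eq_square algebra_simps)

text \<open>The subspace \<open>V\<close> will be the row space of \<open>X\<close>.\<close>

lemma outer_objective_local_min:
  fixes A :: "real^'n^'k"
  assumes svd: "is_svd A s u v" and nz: "a \<noteq> 0" "c \<noteq> 0"
    and c_in: "c \<in> V" and V: "subspace V" "a v* A \<in> V" "v 0 \<in> V"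
    and min: "\<And>(\<alpha> :: real \<Rightarrow> real^'k) (\<gamma> :: real \<Rightarrow> real^'n).
      isCont \<alpha> 0 \<Longrightarrow> isCont \<gamma> 0 \<Longrightarrow>
      \<alpha> 0 = a \<Longrightarrow> \<gamma> 0 = c \<Longrightarrow> (\<And>t. \<gamma> t \<in> V) \<Longrightarrow>
      \<forall>\<^sub>F t in at_right 0. outer_objective A a c \<le> outer_objective A (\<alpha> t) (\<gamma> t)"
  shows "outer_objective A a c = - (s 0)\<^sup>2"
proof -
  have Ac: "A *v c = (norm c)\<^sup>2 *\<^sub>R a"
  proof -
    \<comment> \<open>Up to a factor, \<open>d\<close> is the negative gradient in \<open>a\<close>.
      Moving along it changes the objective to first order by \<open>- 2 * (d \<bullet> d)\<close>,
      so \<open>d\<close> must vanish.\<close>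
    define d where "d = A *v c - (norm c)\<^sup>2 *\<^sub>R a"
    have "\<forall>\<^sub>F t in at_right 0. outer_objective A a c \<le> outer_objective A (a + t *\<^sub>R d) c"
      using c_in by (intro min[of "\<lambda>t. a + t *\<^sub>R d" "\<lambda>_. c"]) (auto intro!: continuous_intros)
    moreover have "outer_objective A (a + t *\<^sub>R d) c = outer_objective A a c
        + (t * (- 2 * (d \<bullet> d)) + t\<^sup>2 * ((norm d)\<^sup>2 * (norm c)\<^sup>2))" for t
    proof -
      have "A *v c = d + (norm c)\<^sup>2 *\<^sub>R a"
        by (simp add: d_def)
      then show ?thesis
        unfolding outer_objective_def power_mult_distrib norm_add_scaleR_power2
        by (simp add: inner_add_left inner_add_right inner_commute[of d a] dot_square_norm)
          (simp add: algebra_simps)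
    qed
    ultimately have "0 \<le> - 2 * (d \<bullet> d)"
      by (intro eventually_at_right_quadratic_nonneg[of _ "(norm d)\<^sup>2 * (norm c)\<^sup>2"])
        (simp only: le_add_same_cancel1)
    then have "d = 0"
      by (simp add: dot_square_norm)
    then show ?thesis
      by (simp add: d_def)
  qed
  have aA: "a v* A = (norm a)\<^sup>2 *\<^sub>R c"
  proof -
    \<comment> \<open>The same argument in the other factor; this descent direction is admissible
      because it lies in \<open>V\<close>.\<close>
    define d where "d = a v* A - (norm a)\<^sup>2 *\<^sub>R c"
    have d: "d \<in> V"
      using c_in V by (simp add: d_def subspace_diff subspace_scale)
    then have "\<forall>\<^sub>F t in at_right 0. outer_objective A a c \<le> outer_objective A a (c + t *\<^sub>R d)"
      using c_in V by (intro min[of "\<lambda>_. a" "\<lambda>t. c + t *\<^sub>R d"])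
        (auto intro!: continuous_intros simp: subspace_add subspace_scale)
    moreover have "outer_objective A a (c + t *\<^sub>R d) = outer_objective A a c
        + (t * (- 2 * (d \<bullet> d)) + t\<^sup>2 * ((norm d)\<^sup>2 * (norm a)\<^sup>2))" for t
    proof -
      have "a v* A = d + (norm a)\<^sup>2 *\<^sub>R c"
        by (simp add: d_def)
      then show ?thesis
        unfolding outer_objective_def power_mult_distrib norm_add_scaleR_power2
          dot_lmul_matrix[symmetric]
        by (simp add: inner_add_left inner_add_right inner_commute[of d c] dot_square_norm)
          (simp add: algebra_simps)
    qed
    ultimately have "0 \<le> - 2 * (d \<bullet> d)"
      by (intro eventually_at_right_quadratic_nonneg[of _ "(norm d)\<^sup>2 * (norm a)\<^sup>2"])
        (simp only: le_add_same_cancel1)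
    then have "d = 0"
      by (simp add: dot_square_norm)
    then show ?thesis
      by (simp add: d_def)
  qed
  let ?t = "norm a * norm c"
  have obj: "a \<bullet> (A *v c) = ?t\<^sup>2"
    by (simp add: Ac dot_square_norm power_mult_distrib)
  have t_pos: "0 < ?t"
    using nz by simp
  have s_nonneg: "0 \<le> s 0"
    using svd by (simp add: is_svd_def)
  \<comment> \<open>Stationarity makes the objective equal to \<open>- ?t\<^sup>2\<close>, so it
    remains to rule out a singular value \<open>?t\<close> below the top one.\<close>
  have "?t = s 0"
  proof (rule ccontr)
    assume neq: "?t \<noteq> s 0"
    have "?t * ?t \<le> s 0 * ?t"
      using is_svd_inner_le[OF svd, of a c] obj by (simp add: power2_eq_square)
    with t_pos have "?t \<le> s 0"
      by (rule mult_right_le_imp_le[rotated])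
    with neq have less: "?t < s 0"
      by simp
    have top: "A *v v 0 = s 0 *\<^sub>R u 0" "u 0 v* A = s 0 *\<^sub>R v 0"
      using is_svd_singular_pair[OF svd, of 0] by auto
    \<comment> \<open>Evaluating the form at mixed pairs in two ways links the two inner products.
      Since \<open>?t\<close> differs from \<open>s 0\<close>, both must be 0: singular vectors for
      different singular values are orthogonal.\<close>
    have 1: "s 0 * (v 0 \<bullet> c) = (norm c)\<^sup>2 * (u 0 \<bullet> a)"
      using dot_lmul_matrix[of "u 0" A c] by (simp add: top Ac)
    have 2: "s 0 * (u 0 \<bullet> a) = (norm a)\<^sup>2 * (v 0 \<bullet> c)"
      using dot_lmul_matrix[of a A "v 0"] by (simp add: top aA inner_commute)
    have "(s 0)\<^sup>2 * (u 0 \<bullet> a) = ?t\<^sup>2 * (u 0 \<bullet> a)"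
    proof -
      have "(s 0)\<^sup>2 * (u 0 \<bullet> a) = (norm a)\<^sup>2 * (s 0 * (v 0 \<bullet> c))"
        by (simp add: power2_eq_square[of "s 0"] 2 mult_ac)
      then show ?thesis
        by (simp add: 1 power_mult_distrib)
    qed
    moreover have "?t\<^sup>2 < (s 0)\<^sup>2"
      using less t_pos by (intro power_strict_mono) auto
    ultimately have ua: "u 0 \<bullet> a = 0"
      by auto
    then have vc: "v 0 \<bullet> c = 0"
      using 1 less t_pos by auto
    \<comment> \<open>Both factors rotate towards the top pair. Orthogonality keeps their norms
      constant, so only the bilinear term of the objective varies.\<close>
    define \<alpha> where "\<alpha> t = cos t *\<^sub>R a + (sin t * norm a) *\<^sub>R u 0" for t
    define \<gamma> where "\<gamma> t = cos t *\<^sub>R c + (sin t * norm c) *\<^sub>R v 0" for t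
    have pyth: "(norm (cos t *\<^sub>R x + (sin t * norm x) *\<^sub>R y))\<^sup>2 = (norm x)\<^sup>2"
      if "norm y = 1" "y \<bullet> x = 0" for t and x y :: "'b::real_inner"
    proof -
      have "(norm (cos t *\<^sub>R x + (sin t * norm x) *\<^sub>R y))\<^sup>2
          = (norm x)\<^sup>2 * ((sin t)\<^sup>2 + (cos t)\<^sup>2)"
        using that unfolding norm_add_scaleR_power2
        by (simp add: inner_commute[of x y] power_mult_distrib distrib_left del: sin_cos_squared_add)
      then show ?thesis
        by simp
    qed
    have objective: "outer_objective A (\<alpha> t) (\<gamma> t)
        = outer_objective A a c - 2 * ?t * (s 0 - ?t) * (sin t)\<^sup>2" for t
    proof -
      have "(norm (\<alpha> t))\<^sup>2 = (norm a)\<^sup>2" "(norm (\<gamma> t))\<^sup>2 = (norm c)\<^sup>2"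
        unfolding \<alpha>_def \<gamma>_def using pyth is_svd_norm_0[OF svd] ua vc by blast+
      moreover have "A *v \<gamma> t = (cos t * (norm c)\<^sup>2) *\<^sub>R a + (sin t * norm c * s 0) *\<^sub>R u 0"
        by (simp add: \<gamma>_def matrix_vector_right_distrib matrix_vector_mult_scaleR Ac top)
      then have "\<alpha> t \<bullet> (A *v \<gamma> t) = (cos t)\<^sup>2 * ?t\<^sup>2 + (sin t)\<^sup>2 * (?t * s 0)"
        using ua is_svd_norm_0[OF svd]
        by (simp add: \<alpha>_def inner_add_left inner_add_right inner_commute[of a "u 0"] dot_square_norm)
          (simp add: power2_eq_square mult_ac)
      ultimately show ?thesis
        unfolding outer_objective_def power_mult_distrib obj cos_squared_eq
        by (simp add: algebra_simps power2_eq_square)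
    qed
    have "\<forall>\<^sub>F t in at_right 0. outer_objective A a c \<le> outer_objective A (\<alpha> t) (\<gamma> t)"
    proof (rule min)
      show "isCont \<alpha> 0" "isCont \<gamma> 0"
        unfolding \<alpha>_def \<gamma>_def by (intro continuous_intros)+
      show "\<gamma> t \<in> V" for t
        unfolding \<gamma>_def using c_in V by (intro subspace_add subspace_scale)
    qed (simp_all add: \<alpha>_def \<gamma>_def)
    moreover have "\<forall>\<^sub>F t in at_right 0. 0 < sin (t :: real)"
      unfolding eventually_at_right_field by (intro exI[of _ pi]) (auto intro: sin_gt_zero)
    ultimately have "\<forall>\<^sub>F t in at_right (0::real). False"
    proof eventually_elim
      case (elim t)
      then have "0 < 2 * ?t * (s 0 - ?t) * (sin t)\<^sup>2"
        using t_pos less by (intro mult_pos_pos) auto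
      with elim(1) show False
        unfolding objective by linarith
    qed
    then show False
      by simp
  qed
  then show ?thesis
    using obj by (simp add: outer_objective_def)
qed

theorem theorem11:
  fixes X :: "real^'n^'m" and Y :: "real^'n^'k" and A :: "real^'n^'k"
  assumes full_row_rank: "rank X = CARD('m)"
    and A_def: "A = Y ** pseudo_inverse X ** X"
    and distinct_singular_values:
      "\<forall>i<min_dim A. \<forall>j<min_dim A. i \<noteq> j \<longrightarrow> singular_value A i \<noteq> 0 \<longrightarrow>
         singular_value A j \<noteq> 0 \<longrightarrow> singular_value A i \<noteq> singular_value A j"
    and rank_A: "rank A \<ge> 1"
  shows "strict_local_min_on rank_one_matrices (F0 X Y) (rrr_solution 1 X Y) \<and>
         (\<forall>W\<in>rank_one_matrices. strict_local_min_on rank_one_matrices (F0 X Y) W \<longrightarrow>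
            W = rrr_solution 1 X Y)"
proof -
  define s where "s = singular_value A"
  obtain u v where svd: "is_svd A s u v"
    unfolding s_def singular_value_def using someI_ex[OF exists_svd[of A]] by blast
  have "A \<noteq> 0"
    using rank_A by auto
  then have pos: "0 < s 0"
    using is_svd_pos[OF svd] by simp
  \<comment> \<open>Distinctness is assumed for nonzero values only; a value equal to the positive
    \<open>s 0\<close> would be nonzero.\<close>
  have simple: "s i < s 0" if "0 < i" "i < min_dim A" for i
  proof -
    have "s i \<le> s 0"
      using svd that unfolding is_svd_def by blast
    moreover have "s i \<noteq> s 0"
      using distinct_singular_values that pos unfolding s_def[symmetric]
      by (metis gr_implies_not0 less_irrefl less_trans)
    ultimately show ?thesis
      by simp
  qed
  let ?P = "pseudo_inverse X"
  let ?R = "rrr_solution 1 X Y"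
  note XP = matrix_mult_pseudo_inverse[OF full_row_rank]
  note F0 = F0_outer_product[OF full_row_rank, of Y, folded A_def]
  have R: "?R = outer_product (s 0 *\<^sub>R u 0) (v 0 v* ?P)"
    unfolding rrr_solution_def A_def[symmetric]
    by (simp only: truncated_svd_1[OF svd pos simple] outer_product_matrix_mult
        flip: outer_product_scaleR(1))
  \<comment> \<open>Since \<open>s 0\<close> is nonzero, \<open>v 0\<close> is a multiple of
    \<open>u 0 v* A\<close> and so lies in the row space of \<open>X\<close>.\<close>
  have v0: "(v 0 v* ?P) v* X = v 0"
  proof -
    have "u 0 v* A = s 0 *\<^sub>R v 0"
      using is_svd_singular_pair[OF svd, of 0] by simp
    then have "s 0 *\<^sub>R ((v 0 v* ?P) v* X) = s 0 *\<^sub>R v 0"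
      using vector_mult_pseudo_inverse_cancel[OF full_row_rank, of "u 0" Y, folded A_def]
      by (simp add: scaleR_vector_matrix_assoc)
    with pos show ?thesis
      by simp
  qed
  have F0_R: "F0 X Y ?R = (- (s 0)\<^sup>2 + (norm Y)\<^sup>2) / 2"
    unfolding R F0 v0 by (simp only: outer_objective_is_svd[OF svd])
  have R_in: "?R \<in> rank_one_matrices"
  proof -
    have "u 0 \<noteq> 0" "v 0 \<noteq> 0"
      using is_svd_norm_0[OF svd] by auto
    moreover from this have "v 0 v* ?P \<noteq> 0"
      using v0 by auto
    ultimately show ?thesis
      using pos unfolding R mem_rank_one_matrices_iff
      by (metis less_irrefl scaleR_eq_0_iff)
  qed
  \<comment> \<open>Multiplication by \<open>?P\<close> on the right undoes multiplication by
    \<open>X\<close>, so uniqueness of the optimal outer product transfers to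
    \<open>W\<close>.\<close>
  have unique: "outer_product a b = ?R" if "outer_objective A a (b v* X) \<le> - (s 0)\<^sup>2" for a b
  proof -
    have "outer_product a b = outer_product a (b v* X) ** ?P"
      by (simp add: outer_product_matrix_mult vector_matrix_mul_assoc XP)
    also have "\<dots> = (s 0 *\<^sub>R outer_product (u 0) (v 0)) ** ?P"
      by (simp only: outer_objective_eq[OF svd pos simple that])
    also have "\<dots> = ?R"
      unfolding R by (simp only: outer_product_matrix_mult flip: outer_product_scaleR(1))
    finally show ?thesis .
  qed
  \<comment> \<open>The minimum is strict globally, so the whole rank-one set serves as the
    neighbourhood.\<close>
  have "F0 X Y ?R < F0 X Y W" if W_in: "W \<in> rank_one_matrices - {?R}" for W
  proof -
    obtain a b where W: "W = outer_product a b"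
      using W_in by (auto simp: mem_rank_one_matrices_iff)
    with W_in unique have "- (s 0)\<^sup>2 < outer_objective A a (b v* X)"
      by (metis DiffD2 insertI1 not_le)
    then show ?thesis
      unfolding W F0_R F0 by (intro divide_strict_right_mono add_strict_right_mono) simp_all
  qed
  then have "strict_local_min_on rank_one_matrices (F0 X Y) ?R"
    unfolding strict_local_min_on_def using R_in openin_subtopology_self by blast
  moreover have "W = ?R"
    if W_in: "W \<in> rank_one_matrices" and min: "strict_local_min_on rank_one_matrices (F0 X Y) W" for W
  proof -
    obtain a b where ab: "a \<noteq> 0" "b \<noteq> 0" and W: "W = outer_product a b"
      using W_in by (auto simp: mem_rank_one_matrices_iff)
    \<comment> \<open>The row space of \<open>X\<close>, as the fixed points of the
      projection.\<close>
    let ?V = "{c. (c v* ?P) v* X = c}"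
    have b: "(b v* X) v* ?P = b"
      by (simp add: vector_matrix_mul_assoc XP)
    have "outer_objective A a (b v* X) = - (s 0)\<^sup>2"
    proof (rule outer_objective_local_min[OF svd ab(1)])
      show "b v* X \<noteq> 0"
        using ab(2) b by auto
      show "b v* X \<in> ?V"
        by (simp add: b)
      show "subspace ?V"
        by (simp add: subspace_def vector_matrix_left_distrib scaleR_vector_matrix_assoc)
      show "a v* A \<in> ?V"
        using vector_mult_pseudo_inverse_cancel[OF full_row_rank, of a Y] by (simp add: A_def)
      show "v 0 \<in> ?V"
        by (simp add: v0)
      fix \<alpha> :: "real \<Rightarrow> real^'k" and \<gamma> :: "real \<Rightarrow> real^'n"
      assume cont: "isCont \<alpha> 0" "isCont \<gamma> 0" and 0: "\<alpha> 0 = a" "\<gamma> 0 = b v* X"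
        and \<gamma>: "\<And>t. \<gamma> t \<in> ?V"
      \<comment> \<open>Pulls a curve in the row space back to the factor \<open>b\<close>; because
        \<open>\<gamma>\<close> stays in \<open>?V\<close>, multiplying by \<open>X\<close> recovers
        it.\<close>
      define \<beta> where "\<beta> t = \<gamma> t v* ?P" for t
      have "isCont \<beta> 0"
        unfolding \<beta>_def transpose_matrix_vector[symmetric]
        by (intro bounded_linear.isCont[OF matrix_vector_mul_bounded_linear] cont)
      moreover have "\<beta> 0 = b"
        by (simp add: \<beta>_def 0 b)
      ultimately have "\<forall>\<^sub>F t in at_right 0. F0 X Y W \<le> F0 X Y (outer_product (\<alpha> t) (\<beta> t))"
        using strict_local_min_on_rank_one_eventually[of "F0 X Y" \<alpha> \<beta>] min cont(1)
        by (simp add: W 0)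
      moreover have "\<beta> t v* X = \<gamma> t" for t
        using \<gamma> by (simp add: \<beta>_def)
      ultimately show "\<forall>\<^sub>F t in at_right 0.
          outer_objective A a (b v* X) \<le> outer_objective A (\<alpha> t) (\<gamma> t)"
        unfolding W F0 by (simp add: divide_le_cancel)
    qed
    then show ?thesis
      using unique W by simp
  qed
  ultimately show ?thesis
    by blast
qed

end
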